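(* Let $\mathrm{R}_4=\{a_0,a_1,a_2,a_3\}$ be the dihedral quandle of order 4, and put $e_i=a_i-a_0\in\mathbb{Z}[\mathrm{R}_4]$ for $i=1,2,3$. (1) $\Delta^2(\mathrm{R}_4)$ is generated as an abelian group by the set $\{e_1-e_2-e_3,\ 2e_2\}$, and $\Delta(\mathrm{R}_4)/\Delta^2(\mathrm{R}_4)\cong\mathbb{Z}\oplus\mathbb{Z}_2$. (2) If $k>2$, then $\Delta^k(\mathrm{R}_4)$ is generated as an abelian group by the set $\{2^{k-2}(e_1-e_2-e_3),\ 2^{k-1}e_2\}$, and $\Delta^{k-1}(\mathrm{R}_4)/\Delta^k(\mathrm{R}_4)\cong\mathbb{Z}_2\oplus\mathbb{Z}_2$.
   Context: The dihedral quandle $\mathrm{R}_n=\{a_0,\dots,a_{n-1}\}$ has operation $a_i.a_j=a_{2j-i}$, indices modulo $n$. $\mathbb{Z}[\mathrm{R}_n]$ is the free abelian group on $\mathrm{R}_n$ with the bilinear extension of this operation as (non-associative) multiplication. $\Delta(\mathrm{R}_n)$ is the kernel of the augmentation map $\mathbb{Z}[\mathrm{R}_n]\to\mathbb{Z}$, $\sum_i\alpha_i a_i\mapsto\sum_i\alpha_i$. Powers: $\Delta^1=\Delta$, and for $k\ge2$, $\Delta^k$ is the additive subgroup generated by all products $u.v$ with $u\in\Delta^i$, $v\in\Delta^j$, $i,j\geq1$, $i+j=k$. $\mathbb{Z}_m=\mathbb{Z}/m\mathbb{Z}$. *)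

theory Defs
  imports "HOL-Algebra.Free_Abelian_Groups"
begin

(* The element a_i of R_n is represented by its residue i in {0..<int n}. *)

definition dihedral_carrier :: "nat \<Rightarrow> int set" where
  "dihedral_carrier n = {0..<int n}"

definition dihedral_op :: "nat \<Rightarrow> int \<Rightarrow> int \<Rightarrow> int" where
  "dihedral_op n i j = (2 * j - i) mod int n"

definition ZR :: "nat \<Rightarrow> (int \<Rightarrow>\<^sub>0 int) monoid" where
  "ZR n = free_Abelian_group (dihedral_carrier n)"

(* The bilinear extension of the quandle operation. *)

definition ZR_mult :: "nat \<Rightarrow> (int \<Rightarrow>\<^sub>0 int) \<Rightarrow> (int \<Rightarrow>\<^sub>0 int) \<Rightarrow> (int \<Rightarrow>\<^sub>0 int)" where
  "ZR_mult n u v = frag_extend (\<lambda>i. frag_extend (\<lambda>j. frag_of (dihedral_op n i j)) v) u"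

definition augmentation :: "(int \<Rightarrow>\<^sub>0 int) \<Rightarrow> int" where
  "augmentation u = (\<Sum>i\<in>Poly_Mapping.keys u. Poly_Mapping.lookup u i)"

definition Delta :: "nat \<Rightarrow> (int \<Rightarrow>\<^sub>0 int) set" where
  "Delta n = kernel (ZR n) integer_group augmentation"

(* The conditions on i and j come first so that conj_cong exposes i, j < k to the termination proof.
   Powers are only meaningful for k \<ge> 1; Delta_pow n 0 is a dummy value. *)

context
  notes conj_cong [fundef_cong]
begin

fun Delta_pow :: "nat \<Rightarrow> nat \<Rightarrow> (int \<Rightarrow>\<^sub>0 int) set" where
  "Delta_pow n k =
     (if k \<le> 1 then Delta n
      else generate (ZR n)
        {ZR_mult n u v | u v i j.
           1 \<le> i \<and> 1 \<le> j \<and> i + j = k \<and> u \<in> Delta_pow n i \<and> v \<in> Delta_pow n j})"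

end

declare Delta_pow.simps [simp del]

definition e :: "int \<Rightarrow> (int \<Rightarrow>\<^sub>0 int)" where
  "e i = frag_of i - frag_of 0"

(* The quotient Delta^k / Delta^l, meaningful when Delta^l is contained in Delta^k. *)

definition Delta_quot :: "nat \<Rightarrow> nat \<Rightarrow> nat \<Rightarrow> (int \<Rightarrow>\<^sub>0 int) set monoid" where
  "Delta_quot n k l = (ZR n)\<lparr>carrier := Delta_pow n k\<rparr> Mod Delta_pow n l"

end

theory Submission
  imports Defs
begin

text \<open>
  Write \<open>f = e\<^sub>1 - e\<^sub>2 - e\<^sub>3\<close>; then \<open>f, e\<^sub>2, e\<^sub>3\<close> is a basis of \<open>\<Delta>\<close>. In these coordinates
  \<open>u . v = r(v) T(u)\<close>, where \<open>r\<close> is the \<open>e\<^sub>3\<close>-coordinate and \<open>T\<close> is an additive map into the span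
  of \<open>f\<close> and \<open>2 e\<^sub>2\<close>. Hence a product vanishes when its right factor lies in a
  proper power, so that \<open>\<Delta>\<^sup>k\<close> is generated by \<open>T(\<Delta>\<^bsup>k-1\<^esup>)\<close>, and the generators follow from
  \<open>T f = 2 f + 4 e\<^sub>2\<close>, \<open>T e\<^sub>2 = - 2 e\<^sub>2\<close> and \<open>T e\<^sub>3 = - f - 2 e\<^sub>2\<close>.
\<close>

section \<open>Coordinates on the augmentation ideal\<close>

definition comb :: "int \<Rightarrow> int \<Rightarrow> int \<Rightarrow> (int \<Rightarrow>\<^sub>0 int)" where
  "comb p q r = frag_cmul p (e 1 - e 2 - e 3) + frag_cmul q (e 2) + frag_cmul r (e 3)"

text \<open>Since \<open>f\<close> is \<open>a_0 + a_1 - a_2 - a_3\<close>, the coordinates can be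
  read back from the coefficients: \<open>p\<close> is the one at 1, \<open>q\<close> the sum of
  those at 1 and 2, \<open>r\<close> the sum of those at 1 and 3.\<close>

lemma lookup_comb:
  "Poly_Mapping.lookup (comb p q r) i =
     (if i = 0 then p - q - r else if i = 1 then p else if i = 2 then q - p
      else if i = 3 then r - p else 0)"
  by (auto simp: comb_def e_def lookup_add lookup_minus algebra_simps simp del: single_one)

lemma comb_eq_iff [simp]: "comb p q r = comb p' q' r' \<longleftrightarrow> p = p' \<and> q = q' \<and> r = r'"
proof
  assume eq: "comb p q r = comb p' q' r'"
  have "Poly_Mapping.lookup (comb p q r) i = Poly_Mapping.lookup (comb p' q' r') i" for i
    by (simp only: eq)
  from this[of 1] this[of 2] this[of 3] show "p = p' \<and> q = q' \<and> r = r'"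
    by (simp add: lookup_comb)
qed simp

lemma comb_zero [simp]: "comb 0 0 0 = 0"
  by (simp add: comb_def)

lemma comb_add: "comb p q r + comb p' q' r' = comb (p + p') (q + q') (r + r')"
  by (rule poly_mapping_eqI) (simp add: lookup_comb lookup_add)

lemma comb_uminus: "- comb p q r = comb (- p) (- q) (- r)"
  by (rule poly_mapping_eqI) (simp add: lookup_comb)

lemma frag_cmul_comb: "frag_cmul c (comb p q r) = comb (c * p) (c * q) (c * r)"
  by (rule poly_mapping_eqI) (simp add: lookup_comb algebra_simps)

lemma keys_comb: "Poly_Mapping.keys (comb p q r) \<subseteq> dihedral_carrier 4"
  by (auto simp: in_keys_iff lookup_comb dihedral_carrier_def split: if_splits)

lemma dihedral_carrier_4: "dihedral_carrier 4 = {0, 1, 2, 3}"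
  by (auto simp: dihedral_carrier_def)

lemma augmentation_eq:
  assumes "Poly_Mapping.keys u \<subseteq> {0, 1, 2, 3}"
  shows "augmentation u = Poly_Mapping.lookup u 0 + Poly_Mapping.lookup u 1
           + Poly_Mapping.lookup u 2 + Poly_Mapping.lookup u 3"
proof -
  have "augmentation u = (\<Sum>i\<in>{0, 1, 2, 3}. Poly_Mapping.lookup u i)"
    unfolding augmentation_def
    by (rule sum.mono_neutral_left) (use assms in \<open>auto simp: in_keys_iff\<close>)
  then show ?thesis by simp
qed

lemma Delta_4: "Delta 4 = {comb p q r | p q r. True}"
proof (intro equalityI subsetI)
  fix u assume "u \<in> Delta 4"
  then have keys: "Poly_Mapping.keys u \<subseteq> {0, 1, 2, 3}" and "augmentation u = 0"
    by (auto simp: Delta_def kernel_def ZR_def dihedral_carrier_4)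
  then have sum0: "Poly_Mapping.lookup u 0 + Poly_Mapping.lookup u 1
      + Poly_Mapping.lookup u 2 + Poly_Mapping.lookup u 3 = 0"
    by (simp add: augmentation_eq)
  \<comment> \<open>The coordinates solve \<open>lookup_comb\<close> at the indices 1, 2, 3;
    agreement at index 0 is then \<open>sum0\<close>.\<close>
  have "u = comb (Poly_Mapping.lookup u 1) (Poly_Mapping.lookup u 1 + Poly_Mapping.lookup u 2)
          (Poly_Mapping.lookup u 1 + Poly_Mapping.lookup u 3)"
  proof (rule poly_mapping_eqI)
    fix i
    have "Poly_Mapping.lookup u i = 0" if "i \<notin> {0, 1, 2, 3}"
      using that keys by (auto simp: in_keys_iff)
    then show "Poly_Mapping.lookup u i =
      Poly_Mapping.lookup (comb (Poly_Mapping.lookup u 1)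
        (Poly_Mapping.lookup u 1 + Poly_Mapping.lookup u 2)
        (Poly_Mapping.lookup u 1 + Poly_Mapping.lookup u 3)) i"
      using sum0 by (auto simp: lookup_comb)
  qed
  then show "u \<in> {comb p q r | p q r. True}" by blast
next
  fix u assume "u \<in> {comb p q r | p q r. True}"
  then obtain p q r where u: "u = comb p q r" by blast
  have "augmentation u = 0"
    using keys_comb[of p q r] by (simp add: u augmentation_eq dihedral_carrier_4 lookup_comb)
  then show "u \<in> Delta 4"
    using keys_comb[of p q r] by (simp add: Delta_def kernel_def ZR_def u)
qed

text \<open>Modulo 4 the index \<open>2 * j - i\<close> depends only on the parity of
  \<open>j\<close>. The odd coefficients of the right factor sum to \<open>r'\<close> and the even
  ones to \<open>- r'\<close>, so the product is \<open>r'\<close> times the image of the left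
  factor under the additive map \<open>a_i \<mapsto> a_{2-i} - a_{-i}\<close>. This map is
  \<open>T\<close>.\<close>

lemma ZR_mult_comb:
  "ZR_mult 4 (comb p q r) (comb p' q' r') =
     comb (r' * (2 * p - r)) (r' * (4 * p - 2 * q - 2 * r)) 0"
proof -
  have eq: "comb p q r = frag_cmul (p - q - r) (frag_of 0) + frag_cmul p (frag_of 1)
      + frag_cmul (q - p) (frag_of 2) + frag_cmul (r - p) (frag_of 3)" for p q r
    by (rule poly_mapping_eqI) (auto simp: lookup_comb lookup_add simp del: single_one)
  show ?thesis
    by (rule poly_mapping_eqI)
      (simp add: ZR_mult_def eq[of p q r] eq[of p' q' r'] frag_extend_add frag_extend_cmul
        dihedral_op_def lookup_add lookup_comb del: single_one, auto simp: algebra_simps)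
qed

section \<open>The additive group and its subgroups\<close>

lemma comm_group_ZR: "comm_group (ZR n)"
  by (simp add: ZR_def abelian_free_Abelian_group)

lemma mult_ZR [simp]: "x \<otimes>\<^bsub>ZR n\<^esub> y = x + y"
  by (simp add: ZR_def)

lemma one_ZR [simp]: "\<one>\<^bsub>ZR n\<^esub> = 0"
  by (simp add: ZR_def)

lemma comb_in_ZR: "comb p q r \<in> carrier (ZR 4)"
  using keys_comb by (simp add: ZR_def)

lemma inv_ZR_comb: "inv\<^bsub>ZR 4\<^esub> (comb p q r) = comb (- p) (- q) (- r)"
  using keys_comb by (simp add: ZR_def comb_uminus)

lemma subgroup_Delta_4: "subgroup (Delta 4) (ZR 4)"
proof
  show "\<one>\<^bsub>ZR 4\<^esub> \<in> Delta 4"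
    unfolding one_ZR Delta_4 by (intro CollectI exI[of _ 0]) simp
qed (auto simp: Delta_4 comb_in_ZR inv_ZR_comb comb_add)

text \<open>All powers from the second on have this shape, with powers of two for \<open>a\<close>
  and \<open>b\<close>.\<close>

definition lattice :: "int \<Rightarrow> int \<Rightarrow> (int \<Rightarrow>\<^sub>0 int) set" where
  "lattice a b = {comb p q 0 | p q. a dvd p \<and> b dvd q}"

lemma comb_in_lattice_iff [simp]: "comb p q r \<in> lattice a b \<longleftrightarrow> a dvd p \<and> b dvd q \<and> r = 0"
  by (auto simp: lattice_def)

lemma zero_in_lattice [simp]: "0 \<in> lattice a b"
  using comb_in_lattice_iff[of 0 0 0 a b] by simp

lemma subgroup_lattice: "subgroup (lattice a b) (ZR 4)"
proof
  show "\<one>\<^bsub>ZR 4\<^esub> \<in> lattice a b"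
    by simp
next
  fix x y assume "x \<in> lattice a b" "y \<in> lattice a b"
  then show "x \<otimes>\<^bsub>ZR 4\<^esub> y \<in> lattice a b"
    by (auto simp: lattice_def comb_add)
qed (auto simp: lattice_def comb_in_ZR inv_ZR_comb)

lemma lattice_subset_generate:
  assumes "S \<subseteq> carrier (ZR 4)" "comb a 0 0 \<in> S" "comb 0 b 0 \<in> S"
  shows "lattice a b \<subseteq> generate (ZR 4) S"
proof
  interpret comm_group "ZR 4" by (rule comm_group_ZR)
  fix u assume "u \<in> lattice a b"
  then obtain m n where u: "u = comb (a * m) (b * n) 0"
    by (auto simp: lattice_def elim!: dvdE)
  \<comment> \<open>Integer powers in the additively written group are scalar multiples.\<close>
  have pow: "comb p q r [^]\<^bsub>ZR 4\<^esub> (k::int) = comb (k * p) (k * q) (k * r)" for p q r k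
    using keys_comb by (simp add: ZR_def frag_cmul_comb)
  have "comb a 0 0 [^]\<^bsub>ZR 4\<^esub> m \<otimes>\<^bsub>ZR 4\<^esub> comb 0 b 0 [^]\<^bsub>ZR 4\<^esub> n \<in> generate (ZR 4) S"
    using assms
    by (intro generate.eng subgroup_int_pow_closed[OF generate_is_subgroup] generate.incl)
  then show "u \<in> generate (ZR 4) S"
    by (simp add: pow u comb_add mult.commute)
qed

text \<open>Allows an infinite generating set such as the set of all products: it suffices to bound
  it by the lattice and to find the two lattice generators in it.\<close>

lemma generate_eq_lattice:
  assumes "S \<subseteq> lattice a b" "comb a 0 0 \<in> S" "comb 0 b 0 \<in> S"
  shows "generate (ZR 4) S = lattice a b"
proof -
  interpret comm_group "ZR 4" by (rule comm_group_ZR)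
  have "S \<subseteq> carrier (ZR 4)"
    using assms(1) subgroup.subset[OF subgroup_lattice] by blast
  with assms show ?thesis
    by (intro equalityI generate_subgroup_incl lattice_subset_generate subgroup_lattice)
qed

section \<open>The powers of the augmentation ideal\<close>

lemma Delta_pow_1: "Delta_pow n 1 = Delta n"
  by (simp add: Delta_pow.simps)

text \<open>The induction is strong because the products range over all splittings
  \<open>k = i + j\<close>.\<close>

lemma Delta_pow_4:
  assumes "k \<ge> 2"
  shows "Delta_pow 4 k = lattice (2 ^ (k - 2)) (2 ^ (k - 1))"
  using assms
proof (induction k rule: less_induct)
  case (less k)
  let ?P = "{ZR_mult 4 u v | u v i j.
    1 \<le> i \<and> 1 \<le> j \<and> i + j = k \<and> u \<in> Delta_pow 4 i \<and> v \<in> Delta_pow 4 j}"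
  have "?P \<subseteq> lattice (2 ^ (k - 2)) (2 ^ (k - 1))"
  proof clarify
    fix u v i j
    assume ij: "1 \<le> i" "1 \<le> j" "k = i + j" and u: "u \<in> Delta_pow 4 i" and v: "v \<in> Delta_pow 4 j"
    \<comment> \<open>Treats both kinds of factor at once: in degree 1 the coordinates are
      arbitrary, from degree 2 on the induction hypothesis constrains them.\<close>
    have ex: "\<exists>p q r. w = comb p q r \<and> (2 \<le> m \<longrightarrow> 2 ^ (m - 2) dvd p \<and> 2 ^ (m - 1) dvd q \<and> r = 0)"
      if w: "w \<in> Delta_pow 4 m" and m: "1 \<le> m" "m < k" for w m
    proof (cases "m = 1")
      case True
      then show ?thesis using w by (auto simp: Delta_pow_1[simplified] Delta_4)
    next
      case False
      then have "w \<in> lattice (2 ^ (m - 2)) (2 ^ (m - 1))"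
        using less.IH[of m] w m by simp
      then show ?thesis unfolding lattice_def by blast
    qed
    obtain p q r where uc: "u = comb p q r"
      and ud: "2 \<le> i \<longrightarrow> 2 ^ (i - 2) dvd p \<and> 2 ^ (i - 1) dvd q \<and> r = 0"
      using ex[OF u] ij by auto
    obtain p' q' r' where vc: "v = comb p' q' r'" and vd: "2 \<le> j \<longrightarrow> r' = 0"
      using ex[OF v] ij by auto
    show "ZR_mult 4 u v \<in> lattice (2 ^ (i + j - 2)) (2 ^ (i + j - 1))"
    proof (cases "j = 1")
      case False
      then show ?thesis using vd ij by (simp add: uc vc ZR_mult_comb)
    next
      case j: True
      \<comment> \<open>With \<open>j = 1\<close> the exponents \<open>k - 2\<close> and
        \<open>k - 1\<close> become \<open>i - 1\<close> and \<open>i\<close>. For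
        \<open>i \<ge> 2\<close> the map \<open>T\<close> gains exactly the one factor 2 required in
        each coordinate.\<close>
      have "(2::int) ^ (i - 1) dvd 2 * p - r \<and> (2::int) ^ i dvd 4 * p - 2 * q - 2 * r"
      proof (cases "i = 1")
        case True
        then show ?thesis by simp
      next
        case False
        then obtain m where m: "i = 2 + m"
          using ij le_Suc_ex[of 2 i] by auto
        then show ?thesis
          using ud by (auto intro!: dvd_diff elim!: dvdE)
      qed
      then show ?thesis by (simp add: uc vc ZR_mult_comb j)
    qed
  qed
  moreover have "comb (2 ^ (k - 2)) 0 0 \<in> ?P" "comb 0 (2 ^ (k - 1)) 0 \<in> ?P"
  proof -
    \<comment> \<open>The right factor is \<open>e 3\<close>, for which \<open>r' = 1\<close>, so
      the product is \<open>T u\<close>.\<close>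
    have left: "ZR_mult 4 u (comb 0 0 1) \<in> ?P" if "u \<in> Delta_pow 4 (k - 1)" for u
    proof -
      have "comb 0 0 1 \<in> Delta_pow 4 1"
        unfolding Delta_pow_1 Delta_4 by blast
      with that less.prems show ?thesis
        by (intro CollectI exI[of _ u] exI[of _ "comb 0 0 1"] exI[of _ "k - 1"] exI[of _ 1]) auto
    qed
    have "\<exists>u \<in> Delta_pow 4 (k - 1). ZR_mult 4 u (comb 0 0 1) = comb (2 ^ (k - 2)) 0 0"
    proof (cases "k = 2")
      case True
      \<comment> \<open>\<open>T\<close> sends \<open>e 2 - e 3\<close> to \<open>f\<close>, as the
        multiples of \<open>e 2\<close> cancel.\<close>
      have "comb 0 1 (- 1) \<in> Delta_pow 4 1"
        unfolding Delta_pow_1 Delta_4 by blast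
      with True show ?thesis by (intro bexI[of _ "comb 0 1 (- 1)"]) (auto simp: ZR_mult_comb)
    next
      case False
      then obtain m where m: "k = 3 + m"
        using less.prems le_Suc_ex[of 3 k] by auto
      \<comment> \<open>The summand \<open>2 e 2\<close> is added to \<open>f\<close> so that its
        image cancels the \<open>4 e 2\<close> in \<open>T f\<close>: \<open>T\<close> doubles
        \<open>f\<close> modulo this correction, giving \<open>2 ^ Suc m\<close> times
        \<open>f\<close>.\<close>
      then have "comb (2 ^ m) (2 ^ Suc m) 0 \<in> Delta_pow 4 (k - 1)"
        using less.IH[of "k - 1"] by simp
      with m show ?thesis
        by (intro bexI[of _ "comb (2 ^ m) (2 ^ Suc m) 0"]) (auto simp: ZR_mult_comb)
    qed
    then show "comb (2 ^ (k - 2)) 0 0 \<in> ?P" by (metis (lifting) left)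
    \<comment> \<open>The sign compensates for that in \<open>T (e 2) = - 2 e 2\<close>.\<close>
    have "comb 0 (- (2 ^ (k - 2))) 0 \<in> Delta_pow 4 (k - 1)"
    proof (cases "k = 2")
      case True
      then show ?thesis unfolding Delta_4 by (auto simp: Delta_pow_1[simplified] Delta_4)
    next
      case False
      then show ?thesis using less.IH[of "k - 1"] less.prems by (simp add: numeral_2_eq_2)
    qed
    moreover have "ZR_mult 4 (comb 0 (- (2 ^ (k - 2))) 0) (comb 0 0 1) = comb 0 (2 ^ (k - 1)) 0"
      using less.prems le_Suc_ex[of 2 k] by (auto simp: ZR_mult_comb)
    ultimately show "comb 0 (2 ^ (k - 1)) 0 \<in> ?P" by (metis (lifting) left)
  qed
  ultimately have "generate (ZR 4) ?P = lattice (2 ^ (k - 2)) (2 ^ (k - 1))"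
    by (rule generate_eq_lattice)
  then show ?case
    using less.prems by (subst Delta_pow.simps) (simp only: if_False not_le, simp)
qed

lemma Delta_pow_4_generate:
  assumes "k \<ge> 2"
  shows "Delta_pow 4 k = generate (ZR 4)
    {frag_cmul (2 ^ (k - 2)) (e 1 - e 2 - e 3), frag_cmul (2 ^ (k - 1)) (e 2)}"
proof -
  have "{frag_cmul (2 ^ (k - 2)) (e 1 - e 2 - e 3), frag_cmul (2 ^ (k - 1)) (e 2)}
      = {comb (2 ^ (k - 2)) 0 0, comb 0 (2 ^ (k - 1)) 0}"
    by (simp add: comb_def)
  moreover have "generate (ZR 4) {comb (2 ^ (k - 2)) 0 0, comb 0 (2 ^ (k - 1)) 0}
      = lattice (2 ^ (k - 2)) (2 ^ (k - 1))"
    by (rule generate_eq_lattice) auto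
  ultimately show ?thesis using Delta_pow_4[OF assms] by simp
qed

section \<open>The successive quotients\<close>

lemma FactGroup_subgroup_iso:
  assumes "group G" "subgroup A G" "group H"
    and "\<And>x. x \<in> A \<Longrightarrow> h x \<in> carrier H"
    and "\<And>x y. x \<in> A \<Longrightarrow> y \<in> A \<Longrightarrow> h (x \<otimes>\<^bsub>G\<^esub> y) = h x \<otimes>\<^bsub>H\<^esub> h y"
    and "\<And>z. z \<in> carrier H \<Longrightarrow> \<exists>x\<in>A. h x = z"
    and "B \<subseteq> A" "\<And>x. x \<in> A \<Longrightarrow> x \<in> B \<longleftrightarrow> h x = \<one>\<^bsub>H\<^esub>"
  shows "G\<lparr>carrier := A\<rparr> Mod B \<cong> H"
proof -
  interpret group_hom "G\<lparr>carrier := A\<rparr>" H h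
    using assms(1-5)
    by (auto simp: group_hom_def group_hom_axioms_def hom_def intro: group.subgroup_imp_group)
  have "B = kernel (G\<lparr>carrier := A\<rparr>) H h"
    using assms(7,8) by (auto simp: kernel_def)
  moreover have "h ` carrier (G\<lparr>carrier := A\<rparr>) = carrier H"
    using assms(4,6) by (fastforce simp: image_iff)
  ultimately show ?thesis using FactGroup_iso by simp
qed

text \<open>In coordinates the map below is \<open>comb p q r \<mapsto> (r, q mod 2)\<close>: it
  kills \<open>f\<close>, while \<open>e 3\<close> accounts for the infinite summand and
  \<open>e 2\<close> for the one of order 2.\<close>

lemma Delta_quot_1_2: "Delta_quot 4 1 2 \<cong> integer_group \<times>\<times> integer_mod_group 2"
  unfolding Delta_quot_def
proof (rule FactGroup_subgroup_iso[where h = "\<lambda>u.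
    (Poly_Mapping.lookup u 1 + Poly_Mapping.lookup u 3,
     (Poly_Mapping.lookup u 1 + Poly_Mapping.lookup u 2) mod 2)"])
  show "group (ZR 4)" by (rule comm_group.axioms[OF comm_group_ZR])
  show "group (integer_group \<times>\<times> integer_mod_group 2)" by (simp add: DirProd_group)
  show "subgroup (Delta_pow 4 1) (ZR 4)" by (simp only: Delta_pow_1 subgroup_Delta_4)
  fix z :: "int \<times> int" assume "z \<in> carrier (integer_group \<times>\<times> integer_mod_group 2)"
  then obtain r q where "z = (r, q)" "0 \<le> q" "q < 2"
    by (auto simp: carrier_integer_mod_group)
  then show "\<exists>u\<in>Delta_pow 4 1. (Poly_Mapping.lookup u 1 + Poly_Mapping.lookup u 3,
      (Poly_Mapping.lookup u 1 + Poly_Mapping.lookup u 2) mod 2) = z"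
    unfolding Delta_pow_1 Delta_4 by (intro bexI[of _ "comb 0 q r"]) (auto simp: lookup_comb)
qed (auto simp: Delta_pow_1[simplified] Delta_pow_4 Delta_4 lattice_def lookup_comb comb_add
  carrier_integer_mod_group mod_add_eq even_iff_mod_2_eq_zero)

text \<open>The map sends \<open>comb (a * m) (b * n) 0\<close> to the parities of \<open>m\<close>
  and \<open>n\<close>; as \<open>a\<close> and \<open>b\<close> are nonzero, \<open>div\<close>
  recovers \<open>m\<close> and \<open>n\<close>.\<close>

lemma lattice_quot_iso:
  assumes "a \<noteq> 0" "b \<noteq> 0"
  shows "(ZR 4)\<lparr>carrier := lattice a b\<rparr> Mod lattice (a * 2) (b * 2)
    \<cong> integer_mod_group 2 \<times>\<times> integer_mod_group 2"
proof (rule FactGroup_subgroup_iso[where h = "\<lambda>u.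
    (Poly_Mapping.lookup u 1 div a mod 2,
     (Poly_Mapping.lookup u 1 + Poly_Mapping.lookup u 2) div b mod 2)"])
  show "group (ZR 4)" by (rule comm_group.axioms[OF comm_group_ZR])
  show "group (integer_mod_group 2 \<times>\<times> integer_mod_group 2)" by (simp add: DirProd_group)
  show "subgroup (lattice a b) (ZR 4)" by (rule subgroup_lattice)
  show "lattice (a * 2) (b * 2) \<subseteq> lattice a b" by (auto simp: lattice_def intro: dvd_mult_left)
  fix z :: "int \<times> int" assume "z \<in> carrier (integer_mod_group 2 \<times>\<times> integer_mod_group 2)"
  then obtain m n where "z = (m, n)" "0 \<le> m" "m < 2" "0 \<le> n" "n < 2"
    by (auto simp: carrier_integer_mod_group)
  then show "\<exists>u\<in>lattice a b. (Poly_Mapping.lookup u 1 div a mod 2,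
      (Poly_Mapping.lookup u 1 + Poly_Mapping.lookup u 2) div b mod 2) = z"
    using assms by (intro bexI[of _ "comb (a * m) (b * n) 0"]) (auto simp: lookup_comb)
next
  fix u assume u: "u \<in> lattice a b"
  then obtain m n where "u = comb (a * m) (b * n) 0"
    by (auto simp: lattice_def dvd_def)
  with assms show "u \<in> lattice (a * 2) (b * 2) \<longleftrightarrow>
      (Poly_Mapping.lookup u 1 div a mod 2,
       (Poly_Mapping.lookup u 1 + Poly_Mapping.lookup u 2) div b mod 2)
        = \<one>\<^bsub>integer_mod_group 2 \<times>\<times> integer_mod_group 2\<^esub>"
    by (simp add: lookup_comb even_iff_mod_2_eq_zero)
qed (use assms in \<open>auto simp: lattice_def lookup_comb comb_add carrier_integer_mod_group
  mod_add_eq div_plus_div_distrib_dvd_left\<close>)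

text \<open>For \<open>k > 2\<close> both powers are lattices, and passing from \<open>k - 1\<close>
  to \<open>k\<close> doubles both parameters.\<close>

lemma Delta_quot_4:
  assumes "k > 2"
  shows "Delta_quot 4 (k - 1) k \<cong> integer_mod_group 2 \<times>\<times> integer_mod_group 2"
proof -
  obtain m where m: "k = m + 3"
    using assms le_Suc_ex[of 3 k] by auto
  have "Delta_pow 4 (k - 1) = lattice (2 ^ m) (2 ^ Suc m)"
    using m Delta_pow_4[of "k - 1"] by simp
  moreover have "Delta_pow 4 k = lattice (2 ^ m * 2) (2 ^ Suc m * 2)"
    using m Delta_pow_4[of k] by (simp add: mult.commute eval_nat_numeral)
  ultimately show ?thesis
    unfolding Delta_quot_def using lattice_quot_iso[of "2 ^ m" "2 ^ Suc m"] by simp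
qed

theorem proposition6p3:
  shows "(Delta_pow 4 2 = generate (ZR 4) {e 1 - e 2 - e 3, frag_cmul 2 (e 2)}
          \<and> Delta_quot 4 1 2 \<cong> integer_group \<times>\<times> integer_mod_group 2)
       \<and> (\<forall>k::nat. k > 2 \<longrightarrow>
            Delta_pow 4 k = generate (ZR 4)
              {frag_cmul (2 ^ (k - 2)) (e 1 - e 2 - e 3), frag_cmul (2 ^ (k - 1)) (e 2)}
          \<and> Delta_quot 4 (k - 1) k \<cong> integer_mod_group 2 \<times>\<times> integer_mod_group 2)"
  using Delta_pow_4_generate[of 2] Delta_pow_4_generate Delta_quot_1_2 Delta_quot_4 by simp

end
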